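(* Let $G$ be an infinite discrete group. Every minimal system $(X,G)$ is either almost pairwise IP$^*$-equicontinuous or pairwise IP-sensitive.
   Context: A system $(X,G)$ consists of a (nonempty) compact metric space $X$ with compatible metric $d$ and an infinite discrete group $G$ acting continuously on $X$. It is minimal if it has no proper nonempty closed $G$-invariant subset. A subset of $X$ is residual if it contains a dense $G_\delta$ subset of $X$. For a sequence $\{p_i\}_{i=1}^\infty$ in $G$, $FP(\{p_i\}_{i=1}^\infty)=\{\prod_{i\in\alpha}p_i : \alpha\subset\mathbb{N}\text{ finite nonempty}\}$, products taken in increasing order of indices. $F\subset G$ is an IP-set if $FP(\{p_i\}_{i=1}^\infty)\subset F$ for some infinite sequence $\{p_i\}_{i=1}^\infty$ in $G$; an IP$^*$-set if it meets every IP-set in $G$. A point $x\in X$ is pairwise IP$^*$-equicontinuous if for every $\varepsilon>0$ there is a neighborhood $U$ of $x$ such that for all $y,z\in U$ the set $\{g\in G: d(gy,gz)<\varepsilon\}$ is an IP$^*$-set. $(X,G)$ is almost pairwise IP$^*$-equicontinuous if the set of pairwise IP$^*$-equicontinuous points is residual in $X$. $(X,G)$ is pairwise IP-sensitive if there is $\delta>0$ such that for each nonempty open $U\subset X$ there exist $x_1,x_2\in U$ such that $\{g\in G: d(gx_1,gx_2)>\delta\}$ is an IP-set. *)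

theory Defs
  imports "HOL-Analysis.Analysis" "HOL-Algebra.Group_Action"
begin

definition (in monoid) list_prod :: "'a list \<Rightarrow> 'a" where
  "list_prod xs = foldr (\<otimes>) xs \<one>"

context group
begin

text \<open>Sequences are indexed from 0 instead of 1; they need not be injective, and the set may
  contain the neutral element.\<close>

definition FP :: "(nat \<Rightarrow> 'a) \<Rightarrow> 'a set" where
  "FP p = {list_prod (map p (sorted_list_of_set \<alpha>)) | \<alpha>. finite \<alpha> \<and> \<alpha> \<noteq> {}}"

definition IP_set :: "'a set \<Rightarrow> bool" where
  "IP_set F \<longleftrightarrow> F \<subseteq> carrier G \<and> (\<exists>p. range p \<subseteq> carrier G \<and> FP p \<subseteq> F)"

definition IPstar_set :: "'a set \<Rightarrow> bool" where
  "IPstar_set F \<longleftrightarrow> F \<subseteq> carrier G \<and> (\<forall>A. IP_set A \<longrightarrow> F \<inter> A \<noteq> {})"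

end

definition residual_in :: "'a topology \<Rightarrow> 'a set \<Rightarrow> bool" where
  "residual_in T S \<longleftrightarrow>
     S \<subseteq> topspace T \<and> (\<exists>D \<subseteq> S. gdelta_in T D \<and> T closure_of D = topspace T)"

text \<open>Since the group is discrete, an action is continuous iff every group element acts by a
  continuous map. The action is written \<open>\<phi> g x\<close> for \<open>gx\<close>.\<close>

locale dynamical_system = Metric_space X d + group_action G X \<phi>
  for X :: "'x set" and d :: "'x \<Rightarrow> 'x \<Rightarrow> real"
    and G :: "('g, 'm) monoid_scheme" (structure) and \<phi> :: "'g \<Rightarrow> 'x \<Rightarrow> 'x" +
  assumes nonempty: "X \<noteq> {}"
    and compact: "compact_space mtopology"
    and infinite_group: "infinite (carrier G)"
    and continuous_action: "g \<in> carrier G \<Longrightarrow> continuous_map mtopology mtopology (\<phi> g)"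
begin

definition invariant :: "'x set \<Rightarrow> bool" where
  "invariant A \<longleftrightarrow> A \<subseteq> X \<and> (\<forall>g \<in> carrier G. \<phi> g ` A \<subseteq> A)"

definition minimal :: bool where
  "minimal \<longleftrightarrow> (\<forall>A. closedin mtopology A \<and> invariant A \<and> A \<noteq> {} \<longrightarrow> A = X)"

definition pairwise_IPstar_equicontinuous_at :: "'x \<Rightarrow> bool" where
  "pairwise_IPstar_equicontinuous_at x \<longleftrightarrow>
     (\<forall>\<epsilon>>0. \<exists>U \<subseteq> X. x \<in> mtopology interior_of U \<and>
        (\<forall>y \<in> U. \<forall>z \<in> U. group.IPstar_set G {g \<in> carrier G. d (\<phi> g y) (\<phi> g z) < \<epsilon>}))"

definition almost_pairwise_IPstar_equicontinuous :: bool where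
  "almost_pairwise_IPstar_equicontinuous \<longleftrightarrow>
     residual_in mtopology {x \<in> X. pairwise_IPstar_equicontinuous_at x}"

definition pairwise_IP_sensitive :: bool where
  "pairwise_IP_sensitive \<longleftrightarrow>
     (\<exists>\<delta>>0. \<forall>U. openin mtopology U \<and> U \<noteq> {} \<longrightarrow>
        (\<exists>x\<^sub>1 \<in> U. \<exists>x\<^sub>2 \<in> U. group.IP_set G {g \<in> carrier G. d (\<phi> g x\<^sub>1) (\<phi> g x\<^sub>2) > \<delta>}))"

end

end

theory Submission
  imports Defs
begin

text \<open>If the system is not sensitive, then for every \<open>\<epsilon>\<close> some nonempty open \<open>U\<close> consists of points whose pairs
  are \<open>\<epsilon>\<close>-close along an \<open>IP\<^sup>*\<close>-set of times. Given a nonempty open \<open>V\<close>, minimality and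
  compactness yield a finite \<open>K \<subseteq> G\<close>, depending only on \<open>V\<close>, with \<open>X = \<Union>k\<in>K. k\<^sup>-\<^sup>1 V\<close>. Hence \<open>U\<close> may
  be chosen afterwards, for a modulus \<open>\<epsilon>'\<close> of uniform continuity valid for all \<open>k \<in> K\<close>; it meets
  some \<open>k\<^sup>-\<^sup>1 V\<close>. For \<open>y, z \<in> V \<inter> kU\<close> the times \<open>h\<close> with \<open>d(h k\<^sup>-\<^sup>1 y, h k\<^sup>-\<^sup>1 z) < \<epsilon>'\<close> form an
  \<open>IP\<^sup>*\<close>-set, and so do their conjugates \<open>k h k\<^sup>-\<^sup>1\<close>, at which \<open>y\<close> and \<open>z\<close> are \<open>\<epsilon>\<close>-close. So the
  open set of points with an \<open>\<epsilon>\<close>-good neighbourhood is dense, and the Baire category theorem applies.\<close>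

section \<open>Conjugation of IP-sets and IP*-sets\<close>

context group
begin

lemma list_prod_closed: "set xs \<subseteq> carrier G \<Longrightarrow> list_prod xs \<in> carrier G"
  by (induction xs) (auto simp: list_prod_def)

lemma inv_mult_cancel_left [simp]:
  "\<lbrakk>k \<in> carrier G; x \<in> carrier G\<rbrakk> \<Longrightarrow> inv k \<otimes> (k \<otimes> x) = x"
  "\<lbrakk>k \<in> carrier G; x \<in> carrier G\<rbrakk> \<Longrightarrow> k \<otimes> (inv k \<otimes> x) = x"
  by (simp_all flip: m_assoc)

text \<open>Conjugation is a homomorphism: neighbouring factors \<open>inv k\<close> and
  \<open>k\<close> cancel, and the order of the factors is kept.\<close>

lemma list_prod_conj:
  assumes "k \<in> carrier G" "set xs \<subseteq> carrier G"
  shows "list_prod (map (\<lambda>h. k \<otimes> h \<otimes> inv k) xs) = k \<otimes> list_prod xs \<otimes> inv k"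
  using assms(2)
proof (induction xs)
  case Nil
  then show ?case using assms(1) by (simp add: list_prod_def)
next
  case (Cons x xs)
  let ?P = "list_prod xs"
  have x: "x \<in> carrier G" and P: "?P \<in> carrier G"
    using Cons.prems list_prod_closed by auto
  have "list_prod (map (\<lambda>h. k \<otimes> h \<otimes> inv k) (x # xs)) = (k \<otimes> x \<otimes> inv k) \<otimes> (k \<otimes> ?P \<otimes> inv k)"
    using Cons by (simp add: list_prod_def)
  also have "\<dots> = k \<otimes> (x \<otimes> ?P) \<otimes> inv k"
    using assms(1) x P by (simp add: m_assoc)
  finally show ?case by (simp add: list_prod_def)
qed

lemma FP_conj:
  assumes k: "k \<in> carrier G" and p: "range p \<subseteq> carrier G"
  shows "FP (\<lambda>i. k \<otimes> p i \<otimes> inv k) = (\<lambda>h. k \<otimes> h \<otimes> inv k) ` FP p"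
proof -
  have "list_prod (map (\<lambda>i. k \<otimes> p i \<otimes> inv k) is) = k \<otimes> list_prod (map p is) \<otimes> inv k" for "is"
    using list_prod_conj[OF k, of "map p is"] p by (auto simp: o_def)
  then show ?thesis by (auto simp: FP_def)
qed

lemma IP_set_conj:
  assumes k: "k \<in> carrier G" and A: "IP_set A"
  shows "IP_set ((\<lambda>h. k \<otimes> h \<otimes> inv k) ` A)"
proof -
  obtain p where p: "range p \<subseteq> carrier G" "FP p \<subseteq> A" and AG: "A \<subseteq> carrier G"
    using A by (auto simp: IP_set_def)
  have "range (\<lambda>i. k \<otimes> p i \<otimes> inv k) \<subseteq> carrier G" using k p(1) by auto
  moreover have "FP (\<lambda>i. k \<otimes> p i \<otimes> inv k) \<subseteq> (\<lambda>h. k \<otimes> h \<otimes> inv k) ` A"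
    using FP_conj[OF k p(1)] p(2) by auto
  ultimately show ?thesis using k AG unfolding IP_set_def by blast
qed

lemma IP_set_mono: "IP_set A \<Longrightarrow> A \<subseteq> B \<Longrightarrow> B \<subseteq> carrier G \<Longrightarrow> IP_set B"
  unfolding IP_set_def by blast

lemma IPstar_set_mono: "IPstar_set A \<Longrightarrow> A \<subseteq> B \<Longrightarrow> B \<subseteq> carrier G \<Longrightarrow> IPstar_set B"
  unfolding IPstar_set_def by blast

text \<open>A set missed by \<open>F\<close> lies in the complement of \<open>F\<close>, and IP-sets
  are closed under supersets, so the complement is the only set to test.\<close>

lemma IPstar_set_iff:
  "IPstar_set F \<longleftrightarrow> F \<subseteq> carrier G \<and> \<not> IP_set (carrier G - F)"
proof
  assume "IPstar_set F"
  then show "F \<subseteq> carrier G \<and> \<not> IP_set (carrier G - F)" unfolding IPstar_set_def by blast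
next
  assume F: "F \<subseteq> carrier G \<and> \<not> IP_set (carrier G - F)"
  have "F \<inter> A \<noteq> {}" if A: "IP_set A" for A
  proof
    assume "F \<inter> A = {}"
    moreover have "A \<subseteq> carrier G" using A by (simp add: IP_set_def)
    ultimately have "IP_set (carrier G - F)" using A by (intro IP_set_mono[OF A]) auto
    then show False using F by blast
  qed
  then show "IPstar_set F" using F by (simp add: IPstar_set_def)
qed

text \<open>Conjugating an IP-set \<open>A\<close> by \<open>inv k\<close> gives an IP-set again,
  which \<open>F\<close> meets; conjugating a common element back by \<open>k\<close> returns to
  \<open>A\<close>.\<close>

lemma IPstar_set_conj:
  assumes k: "k \<in> carrier G" and F: "IPstar_set F"
  shows "IPstar_set ((\<lambda>h. k \<otimes> h \<otimes> inv k) ` F)"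
  unfolding IPstar_set_def
proof (intro conjI allI impI)
  show "(\<lambda>h. k \<otimes> h \<otimes> inv k) ` F \<subseteq> carrier G" using k F by (auto simp: IPstar_set_def)
  fix A assume A: "IP_set A"
  then have AG: "A \<subseteq> carrier G" by (simp add: IP_set_def)
  obtain a where a: "a \<in> A" and aF: "inv k \<otimes> a \<otimes> inv (inv k) \<in> F"
    using IP_set_conj[OF inv_closed[OF k] A] F unfolding IPstar_set_def by blast
  have "a = k \<otimes> (inv k \<otimes> a \<otimes> inv (inv k)) \<otimes> inv k"
    using k a AG by (auto simp: m_assoc subset_iff)
  then show "(\<lambda>h. k \<otimes> h \<otimes> inv k) ` F \<inter> A \<noteq> {}" using a aF by blast
qed

end

section \<open>Open sets of IP*-close points\<close>

context dynamical_system
begin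

sublocale group G
  using group_hom by (simp add: group_hom_def)

definition IPstar_close :: "real \<Rightarrow> 'x set \<Rightarrow> bool" where
  "IPstar_close \<epsilon> U \<longleftrightarrow> (\<forall>y\<in>U. \<forall>z\<in>U. IPstar_set {g \<in> carrier G. d (\<phi> g y) (\<phi> g z) < \<epsilon>})"

lemma IPstar_close_mono_set: "IPstar_close \<epsilon> U \<Longrightarrow> V \<subseteq> U \<Longrightarrow> IPstar_close \<epsilon> V"
  unfolding IPstar_close_def by blast

lemma IPstar_close_mono: "IPstar_close \<epsilon> U \<Longrightarrow> \<epsilon> \<le> \<epsilon>' \<Longrightarrow> IPstar_close \<epsilon>' U"
  unfolding IPstar_close_def by (fastforce intro: IPstar_set_mono)

text \<open>A union of open sets rather than a set of points with good neighbourhoods, so that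
  openness is immediate for the Baire argument.\<close>

definition IPstar_points :: "real \<Rightarrow> 'x set" where
  "IPstar_points \<epsilon> = \<Union>{U. openin mtopology U \<and> IPstar_close \<epsilon> U}"

lemma openin_IPstar_points: "openin mtopology (IPstar_points \<epsilon>)"
  by (auto simp: IPstar_points_def)

lemma IPstar_points_mono: "\<epsilon> \<le> \<epsilon>' \<Longrightarrow> IPstar_points \<epsilon> \<subseteq> IPstar_points \<epsilon>'"
  unfolding IPstar_points_def using IPstar_close_mono by blast

text \<open>The interior of a good neighbourhood is a good open set, because closeness of pairs
  passes to subsets.\<close>

lemma equicontinuous_at_iff:
  "pairwise_IPstar_equicontinuous_at x \<longleftrightarrow> (\<forall>\<epsilon>>0. x \<in> IPstar_points \<epsilon>)"
proof -
  have "(\<exists>U \<subseteq> X. x \<in> mtopology interior_of U \<and> IPstar_close \<epsilon> U) \<longleftrightarrow> x \<in> IPstar_points \<epsilon>" for \<epsilon>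
  proof
    assume "\<exists>U \<subseteq> X. x \<in> mtopology interior_of U \<and> IPstar_close \<epsilon> U"
    then obtain U where U: "x \<in> mtopology interior_of U" "IPstar_close \<epsilon> U" by blast
    have "IPstar_close \<epsilon> (mtopology interior_of U)"
      by (rule IPstar_close_mono_set[OF U(2) interior_of_subset])
    then show "x \<in> IPstar_points \<epsilon>"
      using U(1) openin_interior_of[of mtopology U] unfolding IPstar_points_def by blast
  next
    assume "x \<in> IPstar_points \<epsilon>"
    then obtain U where U: "openin mtopology U" "IPstar_close \<epsilon> U" "x \<in> U"
      by (auto simp: IPstar_points_def)
    have "U \<subseteq> X" "mtopology interior_of U = U"
      using openin_subset[OF U(1)] interior_of_openin[OF U(1)] by simp_all
    then show "\<exists>U \<subseteq> X. x \<in> mtopology interior_of U \<and> IPstar_close \<epsilon> U"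
      using U by auto
  qed
  then show ?thesis
    by (simp add: pairwise_IPstar_equicontinuous_at_def IPstar_close_def)
qed

section \<open>Consequences of minimality and compactness\<close>

lemma action_closed: "g \<in> carrier G \<Longrightarrow> x \<in> X \<Longrightarrow> \<phi> g x \<in> X"
  using surj_prop by blast

lemma action_inv:
  assumes "g \<in> carrier G" "x \<in> X"
  shows "\<phi> (inv g) (\<phi> g x) = x"
  using assms orbit_sym_aux by blast

lemma openin_action_preimage:
  "g \<in> carrier G \<Longrightarrow> openin mtopology V \<Longrightarrow> openin mtopology {x \<in> X. \<phi> g x \<in> V}"
  using openin_continuous_map_preimage[OF continuous_action] by simp

text \<open>The points whose orbit misses \<open>V\<close> form a closed invariant set other than
  \<open>X\<close>, hence the empty set; so the preimages of \<open>V\<close> cover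
  \<open>X\<close>, and compactness leaves finitely many.\<close>

lemma minimal_finite_cover:
  assumes "minimal" and V: "openin mtopology V" "V \<noteq> {}"
  obtains K where "finite K" "K \<subseteq> carrier G" "\<And>x. x \<in> X \<Longrightarrow> \<exists>k\<in>K. \<phi> k x \<in> V"
proof -
  let ?P = "\<lambda>g. {x \<in> X. \<phi> g x \<in> V}"
  have VX: "V \<subseteq> X" using openin_subset[OF V(1)] by simp
  define A where "A = X - (\<Union>g\<in>carrier G. ?P g)"
  have "openin mtopology (\<Union>g\<in>carrier G. ?P g)"
    using openin_action_preimage[OF _ V(1)] by (intro openin_Union) (elim imageE, simp)
  then have "closedin mtopology A"
    unfolding A_def using closedin_diff[OF closedin_topspace[of mtopology]] by simp
  moreover have "invariant A"
    unfolding invariant_def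
  proof (intro conjI ballI image_subsetI)
    show "A \<subseteq> X" by (auto simp: A_def)
    fix g x assume g: "g \<in> carrier G" and x: "x \<in> A"
    then have xX: "x \<in> X" by (simp add: A_def)
    have "\<phi> h (\<phi> g x) \<notin> V" if h: "h \<in> carrier G" for h
    proof -
      have "\<phi> h (\<phi> g x) = \<phi> (h \<otimes> g) x" using composition_rule[OF xX h g] by simp
      moreover have "\<phi> (h \<otimes> g) x \<notin> V" using x xX m_closed[OF h g] by (auto simp: A_def)
      ultimately show ?thesis by simp
    qed
    then show "\<phi> g x \<in> A" using action_closed[OF g xX] by (auto simp: A_def)
  qed
  moreover have "A \<noteq> X"
  proof
    assume "A = X"
    moreover obtain v where "v \<in> V" using V by blast
    ultimately have "v \<in> A" using VX by blast
    \<comment> \<open>The orbit of \<open>v\<close> meets \<open>V\<close> already at the neutral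
      element, which acts as the identity restricted to \<open>X\<close>.\<close>
    moreover have "\<phi> \<one> v = v" using id_eq_one VX \<open>v \<in> V\<close> by (metis restrict_apply' subsetD)
    ultimately show False using \<open>v \<in> V\<close> VX unfolding A_def by (auto dest: bspec[OF _ one_closed])
  qed
  ultimately have "A = {}" using assms(1) by (auto simp: minimal_def)
  then have "X \<subseteq> \<Union>(?P ` carrier G)" unfolding A_def by blast
  moreover have "\<forall>T\<in>?P ` carrier G. openin mtopology T"
    using openin_action_preimage[OF _ V(1)] by simp
  ultimately obtain \<F> where \<F>: "finite \<F>" "\<F> \<subseteq> ?P ` carrier G" "X \<subseteq> \<Union>\<F>"
    using compact unfolding compact_space_alt topspace_mtopology by meson
  obtain K where "K \<subseteq> carrier G" "finite K" "\<F> = ?P ` K"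
    using finite_subset_image[OF \<F>(1,2)] by blast
  then have "finite K" "K \<subseteq> carrier G" "X \<subseteq> (\<Union>k\<in>K. ?P k)" using \<F>(3) by simp_all
  then show thesis by (intro that) auto
qed

text \<open>Heine-Cantor on the compact space \<open>X\<close>.\<close>

lemma action_uniformly_continuous:
  assumes "g \<in> carrier G" "\<epsilon> > 0"
  obtains \<delta> where "\<delta> > 0" "\<And>x y. \<lbrakk>x \<in> X; y \<in> X; d x y < \<delta>\<rbrakk> \<Longrightarrow> d (\<phi> g x) (\<phi> g y) < \<epsilon>"
proof -
  have "uniformly_continuous_map (metric (X,d)) (metric (X,d)) (\<phi> g)"
    by (intro continuous_imp_uniformly_continuous_map)
       (use compact continuous_action[OF assms(1)] in simp_all)
  then show thesis
    using assms(2) that unfolding uniformly_continuous_map_def by auto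
qed

lemma finite_action_uniformly_continuous:
  assumes "finite K" "K \<subseteq> carrier G" "\<epsilon> > 0"
  shows "\<exists>\<delta>>0. \<forall>k\<in>K. \<forall>x\<in>X. \<forall>y\<in>X. d x y < \<delta> \<longrightarrow> d (\<phi> k x) (\<phi> k y) < \<epsilon>"
  using assms
proof (induction K)
  case empty
  then show ?case by (auto intro: exI[of _ 1])
next
  case (insert k K)
  obtain \<delta>1 where 1: "\<delta>1 > 0" "\<forall>k\<in>K. \<forall>x\<in>X. \<forall>y\<in>X. d x y < \<delta>1 \<longrightarrow> d (\<phi> k x) (\<phi> k y) < \<epsilon>"
    using insert by auto
  obtain \<delta>2 where 2: "\<delta>2 > 0" "\<And>x y. \<lbrakk>x \<in> X; y \<in> X; d x y < \<delta>2\<rbrakk> \<Longrightarrow> d (\<phi> k x) (\<phi> k y) < \<epsilon>"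
    using action_uniformly_continuous[of k \<epsilon>] insert.prems by auto
  show ?case
    by (rule exI[of _ "min \<delta>1 \<delta>2"]) (use 1 2 in auto)
qed

section \<open>Density of the good points without sensitivity\<close>

lemma nonempty_IPstar_points:
  assumes "\<not> pairwise_IP_sensitive" "\<epsilon> > 0"
  obtains U where "openin mtopology U" "U \<noteq> {}" "IPstar_close \<epsilon> U"
proof -
  \<comment> \<open>Sensitivity is refuted at half of \<epsilon>: the complement of the times with
    distance below \<epsilon> allows equality, while sensitivity asks for a strict
    inequality.\<close>
  have "\<epsilon> / 2 > 0" using assms(2) by simp
  then obtain U where U: "openin mtopology U" "U \<noteq> {}"
    and no: "\<And>x y. x \<in> U \<Longrightarrow> y \<in> U \<Longrightarrow> \<not> IP_set {g \<in> carrier G. d (\<phi> g x) (\<phi> g y) > \<epsilon> / 2}"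
    using assms(1) unfolding pairwise_IP_sensitive_def by meson
  have "IPstar_set {g \<in> carrier G. d (\<phi> g y) (\<phi> g z) < \<epsilon>}" if "y \<in> U" "z \<in> U" for y z
    unfolding IPstar_set_iff
  proof (intro conjI notI)
    assume "IP_set (carrier G - {g \<in> carrier G. d (\<phi> g y) (\<phi> g z) < \<epsilon>})"
    then have "IP_set {g \<in> carrier G. d (\<phi> g y) (\<phi> g z) > \<epsilon> / 2}"
      by (rule IP_set_mono) (use assms(2) in auto)
    then show False using no that by blast
  qed auto
  then show thesis using U that by (simp add: IPstar_close_def)
qed

lemma dense_IPstar_points:
  assumes "minimal" "\<not> pairwise_IP_sensitive" "\<epsilon> > 0"
  shows "mtopology closure_of (IPstar_points \<epsilon>) = X"
proof -
  have "IPstar_points \<epsilon> \<inter> V \<noteq> {}" if V: "openin mtopology V" "V \<noteq> {}" for V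
  proof -
    obtain K where K: "finite K" "K \<subseteq> carrier G" "\<And>x. x \<in> X \<Longrightarrow> \<exists>k\<in>K. \<phi> k x \<in> V"
      using minimal_finite_cover[OF assms(1) V] by blast
    obtain \<epsilon>' where e: "\<epsilon>' > 0"
      and uc: "\<forall>k\<in>K. \<forall>x\<in>X. \<forall>y\<in>X. d x y < \<epsilon>' \<longrightarrow> d (\<phi> k x) (\<phi> k y) < \<epsilon>"
      using finite_action_uniformly_continuous[OF K(1,2) assms(3)] by blast
    obtain U where U: "openin mtopology U" "U \<noteq> {}" "IPstar_close \<epsilon>' U"
      using nonempty_IPstar_points[OF assms(2) e] by blast
    obtain u where u: "u \<in> U" "u \<in> X"
      using U(2) openin_subset[OF U(1)] by auto
    obtain k where k: "k \<in> K" "\<phi> k u \<in> V" using K(3) u by blast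
    have kG: "k \<in> carrier G" using k K by blast
    then have ikG: "inv k \<in> carrier G" by simp
    \<comment> \<open>This is the part of \<open>V\<close> in the translate of \<open>U\<close> by
      \<open>k\<close>, written as a preimage so that it is visibly open. It contains
      \<open>\<phi> k u\<close>.\<close>
    define W where "W = V \<inter> {x \<in> X. \<phi> (inv k) x \<in> U}"
    have "openin mtopology W"
      unfolding W_def using V(1) openin_action_preimage[OF ikG U(1)] by blast
    moreover have "\<phi> k u \<in> W"
      using k u action_inv[OF kG u(2)] action_closed[OF kG u(2)] by (simp add: W_def)
    moreover have "IPstar_close \<epsilon> W"
      unfolding IPstar_close_def
    proof (intro ballI)
      fix y z assume y: "y \<in> W" and z: "z \<in> W"
      let ?F = "{h \<in> carrier G. d (\<phi> h (\<phi> (inv k) y)) (\<phi> h (\<phi> (inv k) z)) < \<epsilon>'}"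
      have "IPstar_set ?F" using U(3) y z by (simp add: IPstar_close_def W_def)
      then have "IPstar_set ((\<lambda>h. k \<otimes> h \<otimes> inv k) ` ?F)" by (rule IPstar_set_conj[OF kG])
      then show "IPstar_set {g \<in> carrier G. d (\<phi> g y) (\<phi> g z) < \<epsilon>}"
      proof (rule IPstar_set_mono)
        \<comment> \<open>The conjugated time acts by \<open>k\<close> last, so the choice of
          \<epsilon>' turns \<epsilon>'-closeness at time \<open>h\<close> into \<epsilon>-closeness
          at the conjugate.\<close>
        have comp: "\<phi> (k \<otimes> h \<otimes> inv k) w = \<phi> k (\<phi> h (\<phi> (inv k) w))"
          if "h \<in> carrier G" "w \<in> X" for h w
          using that kG ikG by (simp add: composition_rule action_closed)
        have yX: "y \<in> X" and zX: "z \<in> X" using y z by (auto simp: W_def)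
        show "(\<lambda>h. k \<otimes> h \<otimes> inv k) ` ?F \<subseteq> {g \<in> carrier G. d (\<phi> g y) (\<phi> g z) < \<epsilon>}"
          using comp yX zX uc k(1) kG ikG by (auto simp: action_closed)
      qed auto
    qed
    ultimately show ?thesis using W_def unfolding IPstar_points_def by blast
  qed
  then show ?thesis
    using dense_intersects_open[of mtopology "IPstar_points \<epsilon>"] by simp
qed

text \<open>The good sets grow with \<epsilon>, so countably many radii suffice, and Baire makes
  their intersection a dense G-delta set.\<close>

lemma residual_if_not_sensitive:
  assumes "minimal" "\<not> pairwise_IP_sensitive"
  shows "almost_pairwise_IPstar_equicontinuous"
proof -
  let ?E = "\<lambda>n::nat. IPstar_points (1 / real (Suc n))"
  have "\<Inter>(range ?E) \<subseteq> {x \<in> X. pairwise_IPstar_equicontinuous_at x}"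
  proof
    fix x assume x: "x \<in> \<Inter>(range ?E)"
    have "x \<in> IPstar_points \<epsilon>" if "\<epsilon> > 0" for \<epsilon>
    proof -
      obtain n where "1 / real (Suc n) < \<epsilon>" using nat_approx_posE[OF \<open>\<epsilon> > 0\<close>] by blast
      then show ?thesis using x IPstar_points_mono[of "1 / real (Suc n)" \<epsilon>] by auto
    qed
    \<comment> \<open>Any positive radius would do here; 1 is an arbitrary choice.\<close>
    moreover have "x \<in> X"
      using calculation[of 1] openin_subset[OF openin_IPstar_points[of 1]] by auto
    ultimately show "x \<in> {x \<in> X. pairwise_IPstar_equicontinuous_at x}"
      by (simp add: equicontinuous_at_iff)
  qed
  moreover have "gdelta_in mtopology (\<Inter>(range ?E))"
    by (rule gdelta_in_Inter) (auto intro: open_imp_gdelta_in openin_IPstar_points)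
  moreover have "mtopology closure_of \<Inter>(range ?E) = X"
  proof (rule metric_Baire_category[OF compact_space_imp_mcomplete[OF compact]])
    fix T assume "T \<in> range ?E"
    then show "openin mtopology T \<and> mtopology closure_of T = X"
      using openin_IPstar_points dense_IPstar_points[OF assms] by auto
  qed auto
  ultimately show ?thesis
    unfolding almost_pairwise_IPstar_equicontinuous_def residual_in_def by auto
qed

section \<open>The two alternatives exclude each other\<close>

lemma sensitive_imp_not_equicontinuous_at:
  assumes "pairwise_IP_sensitive"
  shows "\<not> pairwise_IPstar_equicontinuous_at x"
proof
  assume x: "pairwise_IPstar_equicontinuous_at x"
  obtain \<delta> where \<delta>: "\<delta> > 0" and sens: "\<And>U. openin mtopology U \<Longrightarrow> U \<noteq> {} \<Longrightarrow>
      \<exists>y\<in>U. \<exists>z\<in>U. IP_set {g \<in> carrier G. d (\<phi> g y) (\<phi> g z) > \<delta>}"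
    using assms by (auto simp: pairwise_IP_sensitive_def)
  obtain U where U: "openin mtopology U" "x \<in> U" "IPstar_close \<delta> U"
    using x \<delta> by (auto simp: equicontinuous_at_iff IPstar_points_def)
  obtain y z where yz: "y \<in> U" "z \<in> U" "IP_set {g \<in> carrier G. d (\<phi> g y) (\<phi> g z) > \<delta>}"
    using sens[OF U(1)] U(2) by blast
  have "IPstar_set {g \<in> carrier G. d (\<phi> g y) (\<phi> g z) < \<delta>}"
    using U(3) yz(1,2) by (simp add: IPstar_close_def)
  \<comment> \<open>An IP*-set meets every IP-set, but no time has distance both below and above
    \<delta>.\<close>
  then have "{g \<in> carrier G. d (\<phi> g y) (\<phi> g z) < \<delta>} \<inter> {g \<in> carrier G. d (\<phi> g y) (\<phi> g z) > \<delta>} \<noteq> {}"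
    using yz(3) by (simp add: IPstar_set_def)
  then show False by auto
qed

text \<open>A dense subset of the nonempty space \<open>X\<close> has a point. Sensitivity leaves no
  equicontinuity point, so both alternatives cannot hold together.\<close>

lemma residual_nonempty: "residual_in mtopology S \<Longrightarrow> S \<noteq> {}"
  using nonempty by (auto simp: residual_in_def)

end

theorem theorem3p11:
  fixes X :: "'x set" and d :: "'x \<Rightarrow> 'x \<Rightarrow> real"
    and G :: "('g, 'm) monoid_scheme" and \<phi> :: "'g \<Rightarrow> 'x \<Rightarrow> 'x"
  assumes "dynamical_system X d G \<phi>"
    and "dynamical_system.minimal X d G \<phi>"
  shows "(dynamical_system.almost_pairwise_IPstar_equicontinuous X d G \<phi> \<or>
          dynamical_system.pairwise_IP_sensitive X d G \<phi>) \<and>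
         \<not> (dynamical_system.almost_pairwise_IPstar_equicontinuous X d G \<phi> \<and>
            dynamical_system.pairwise_IP_sensitive X d G \<phi>)"
proof -
  interpret dynamical_system X d G \<phi> by (rule assms(1))
  have "\<not> almost_pairwise_IPstar_equicontinuous" if "pairwise_IP_sensitive"
    using sensitive_imp_not_equicontinuous_at[OF that] residual_nonempty
    unfolding almost_pairwise_IPstar_equicontinuous_def by blast
  then show ?thesis using residual_if_not_sensitive[OF assms(2)] by blast
qed

end
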